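(* Let $\lambda$ be a nonzero real number. For every integer $n\ge 0$, $$\sum_{m=0}^{n}(-1)^{m}d_{m,\lambda}S_{2,-\lambda}(n,m)=\sum_{m=0}^{n}\binom{n}{m}\mathrm{Bel}_{m,-\lambda}(-1)_{n-m,-\lambda},$$ and $$\sum_{k=0}^{n}\mathrm{Bel}_{k,\lambda}S_{1,\lambda}(n,k)=(-1)^{n}(-1)_{n,-\lambda}.$$
   Context: For a nonzero real $\mu$ (used below with $\mu=\lambda$ and $\mu=-\lambda$), the degenerate falling factorial is $(x)_{0,\mu}=1$ and $(x)_{n,\mu}=x(x-\mu)\cdots(x-(n-1)\mu)$ for $n\ge1$; the degenerate exponential function is $e_{\mu}^{x}(t)=(1+\mu t)^{x/\mu}=\sum_{n\ge0}(x)_{n,\mu}\frac{t^n}{n!}$, $e_\mu(t)=e_\mu^1(t)$, and $\log_\mu(t)=\frac{t^\mu-1}{\mu}$ is the compositional inverse of $e_\mu(t)$. The degenerate derangement polynomials $d_{n,\lambda}(x)$ are defined by $\frac{1}{1-t}e_{\lambda}^{x-1}(t)=\sum_{n\ge0}d_{n,\lambda}(x)\frac{t^n}{n!}$, and $d_{n,\lambda}=d_{n,\lambda}(0)$. The fully degenerate Bell polynomials are defined by $e_{\mu}(x(e_{\mu}(t)-1))=\sum_{n\ge0}\mathrm{Bel}_{n,\mu}(x)\frac{t^n}{n!}$, and $\mathrm{Bel}_{n,\mu}=\mathrm{Bel}_{n,\mu}(1)$. The degenerate Stirling numbers of the first kind are defined by $\frac{1}{m!}(\log_\mu(1+t))^m=\sum_{n\ge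 m}S_{1,\mu}(n,m)\frac{t^n}{n!}$, and those of the second kind by $\frac{1}{m!}(e_{\mu}(t)-1)^m=\sum_{n\ge m}S_{2,\mu}(n,m)\frac{t^n}{n!}$, for $m\ge0$. *)

theory Defs
  imports "HOL-Computational_Algebra.Computational_Algebra"
begin

text \<open>
  All generating functions in \<open>t\<close> are formal power series over the reals, with \<open>t\<close> rendered as
  \<^const>\<open>fps_X\<close>.
\<close>

definition deg_falling :: "real \<Rightarrow> real \<Rightarrow> nat \<Rightarrow> real" where
  "deg_falling \<mu> x n = (\<Prod>i<n. x - real i * \<mu>)"

definition deg_exp :: "real \<Rightarrow> real \<Rightarrow> real fps" where
  "deg_exp \<mu> x = Abs_fps (\<lambda>n. deg_falling \<mu> x n / fact n)"

text \<open>The closed form \<open>(1 + \<mu> t) powr (x / \<mu>)\<close>, as a formal binomial series.\<close>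

lemma deg_exp_eq_binomial:
  assumes "\<mu> \<noteq> 0"
  shows "deg_exp \<mu> x = fps_binomial (x / \<mu>) oo (fps_const \<mu> * fps_X)"
proof (rule fps_ext)
  fix n
  have "deg_falling \<mu> x n = (\<Prod>i<n. \<mu> * (x / \<mu> - real i))"
    unfolding deg_falling_def using assms by (intro prod.cong) (auto simp: field_simps)
  also have "\<dots> = \<mu> ^ n * (\<Prod>i<n. x / \<mu> - real i)"
    by (simp add: prod.distrib)
  finally show "fps_nth (deg_exp \<mu> x) n =
      fps_nth (fps_binomial (x / \<mu>) oo (fps_const \<mu> * fps_X)) n"
    by (simp add: deg_exp_def fps_compose_linear gbinomial_prod_rev atLeast0LessThan)
qed

text \<open>
  The series of \<open>log\<^sub>\<mu>(1 + t) = ((1 + t) powr \<mu> - 1) / \<mu>\<close>; \<^const>\<open>fps_binomial\<close> \<open>\<mu>\<close> is the series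
  of \<open>(1 + t) powr \<mu>\<close>.
\<close>

definition deg_log1p :: "real \<Rightarrow> real fps" where
  "deg_log1p \<mu> = fps_const (1 / \<mu>) * (fps_binomial \<mu> - 1)"

definition deg_derangement :: "real \<Rightarrow> nat \<Rightarrow> real \<Rightarrow> real" where
  "deg_derangement \<mu> n x = fact n * fps_nth (1 / (1 - fps_X) * deg_exp \<mu> (x - 1)) n"

definition deg_Bell :: "real \<Rightarrow> nat \<Rightarrow> real \<Rightarrow> real" where
  "deg_Bell \<mu> n x = fact n * fps_nth (deg_exp \<mu> 1 oo (fps_const x * (deg_exp \<mu> 1 - 1))) n"

definition deg_Stirling1 :: "real \<Rightarrow> nat \<Rightarrow> nat \<Rightarrow> real" where
  "deg_Stirling1 \<mu> n m = fact n * fps_nth (fps_const (1 / fact m) * deg_log1p \<mu> ^ m) n"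

definition deg_Stirling2 :: "real \<Rightarrow> nat \<Rightarrow> nat \<Rightarrow> real" where
  "deg_Stirling2 \<mu> n m = fact n * fps_nth (fps_const (1 / fact m) * (deg_exp \<mu> 1 - 1) ^ m) n"

end

(*
  For power series f, g with g(0) = 0, summing (k! [t^k] f) (n!/k! [t^n] g^k) over k gives
  n! [t^n] f(g(t)), so both identities reduce to compositions of generating functions.
  Put E(t) = e_{-lambda}(t).  The derangement series at 1 - E is E^{-1} e_lambda^{-1}(1 - E),
  and e_lambda^{-1}(-u) = e_{-lambda}(u) turns the second factor into the Bell series.
  For the second identity, log_lambda(1 + t) undoes the inner e_lambda of the Bell series and
  leaves e_lambda(t).
*)

theory Submission
  imports Defs
begin

lemma sum_fact_nth_eq_compose:
  fixes f g :: "real fps"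
  shows "(\<Sum>k=0..n. (fact k * fps_nth f k) * (fact n * fps_nth (fps_const (1 / fact k) * g ^ k) n))
           = fact n * fps_nth (f oo g) n"
  unfolding fps_compose_nth sum_distrib_left
  by (intro sum.cong) simp_all

text \<open>The differential equation of (1 + t)^c with its denominator cleared, so that it can be
  composed with another series without handling a quotient.\<close>

lemma one_plus_X_mult_fps_binomial_deriv:
  fixes c :: "'a :: field_char_0"
  shows "(1 + fps_X) * fps_deriv (fps_binomial c) = fps_const c * fps_binomial c"
proof -
  have "is_unit (1 + fps_X :: 'a fps)"
    by simp
  then show ?thesis
    unfolding fps_binomial_deriv by simp
qed

text \<open>Formal version of ((1 + t)^c)^a = (1 + t)^(a c). By the chain rule the composition F
  satisfies (1 + t) F' = a c F with F(0) = 1, which determines the binomial series.\<close>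

lemma fps_binomial_compose_fps_binomial:
  fixes a c :: "'a :: field_char_0"
  shows "fps_binomial a oo (fps_binomial c - 1) = fps_binomial (a * c)"
proof -
  let ?B = "fps_binomial c - 1" and ?D = "fps_deriv (fps_binomial a)"
  let ?F = "fps_binomial a oo ?B"
  have B0: "?B $ 0 = 0"
    by simp
  \<comment> \<open>Substituting \<open>?B\<close> for t turns the factor 1 + t into
    \<open>fps_binomial c\<close>.\<close>
  have "((1 + fps_X) * ?D) oo ?B = fps_binomial c * (?D oo ?B)"
    by (simp only: fps_compose_mult_distrib[OF B0] fps_compose_add_distrib fps_compose_1
        fps_X_fps_compose_startby0[OF B0]) simp
  then have D: "fps_binomial c * (?D oo ?B) = fps_const a * ?F"
    by (simp only: one_plus_X_mult_fps_binomial_deriv fps_compose_mult_distrib[OF B0]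
        fps_const_compose)
  have "(1 + fps_X) * fps_deriv ?F = (?D oo ?B) * ((1 + fps_X) * fps_deriv (fps_binomial c))"
    by (simp add: fps_compose_deriv[OF B0] mult_ac)
  also have "\<dots> = fps_const c * (fps_binomial c * (?D oo ?B))"
    unfolding one_plus_X_mult_fps_binomial_deriv by (simp only: mult_ac)
  also have "\<dots> = fps_const (a * c) * ?F"
    unfolding D by (simp add: mult_ac flip: fps_const_mult)
  finally have eq: "(1 + fps_X) * fps_deriv ?F = fps_const (a * c) * ?F" .
  have "(1 + fps_X :: 'a fps) \<noteq> 0"
    by (metis fps_add_nth fps_one_nth fps_X_nth fps_zero_nth add.right_neutral zero_neq_one)
  then have "fps_deriv ?F = fps_const (a * c) * ?F / (1 + fps_X)"
    unfolding eq[symmetric] by simp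
  then show ?thesis
    by (intro iffD1[OF fps_binomial_ODE_unique']) simp
qed

lemma deg_exp_nth_0: "deg_exp \<mu> x $ 0 = 1"
  by (simp add: deg_exp_def deg_falling_def)

lemma deg_exp_add:
  assumes "\<mu> \<noteq> 0"
  shows "deg_exp \<mu> (x + y) = deg_exp \<mu> x * deg_exp \<mu> y"
  using assms
  by (simp add: deg_exp_eq_binomial add_divide_distrib fps_binomial_add_mult
      fps_compose_mult_distrib)

lemma deg_exp_0: "deg_exp \<mu> 0 = 1"
  by (rule fps_ext) (auto simp: deg_exp_def deg_falling_def)

text \<open>Each of the n factors changes sign. This is the link between the parameters \<mu> and
  -\<mu> in both identities.\<close>

lemma deg_falling_minus: "deg_falling (- \<mu>) (- x) n = (-1) ^ n * deg_falling \<mu> x n"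
  by (induction n) (simp_all add: deg_falling_def algebra_simps)

lemma deg_exp_minus: "deg_exp (- \<mu>) (- x) = deg_exp \<mu> x oo (- fps_X)"
  by (simp add: fps_compose_uminus' deg_exp_def deg_falling_minus)

lemma deg_log1p_nth_0: "deg_log1p \<mu> $ 0 = 0"
  by (simp add: deg_log1p_def)

text \<open>The scaling by \<mu> inside \<open>deg_exp\<close> cancels the factor 1 / \<mu> of
  \<open>deg_log1p\<close>; what remains is a composition of binomial series with exponents 1 /
  \<mu> and \<mu>.\<close>

lemma deg_exp_compose_deg_log1p:
  assumes "\<mu> \<noteq> 0"
  shows "deg_exp \<mu> 1 oo deg_log1p \<mu> = 1 + fps_X"
proof -
  have "(fps_const \<mu> * fps_X) oo deg_log1p \<mu> = fps_const \<mu> * deg_log1p \<mu>"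
    by (simp add: fps_compose_mult_distrib deg_log1p_nth_0)
  also have "\<dots> = fps_binomial \<mu> - 1"
    using assms by (simp add: deg_log1p_def flip: mult.assoc)
  finally have "(fps_const \<mu> * fps_X) oo deg_log1p \<mu> = fps_binomial \<mu> - 1" .
  then have "deg_exp \<mu> 1 oo deg_log1p \<mu> = fps_binomial (1 / \<mu>) oo (fps_binomial \<mu> - 1)"
    using assms
    by (simp add: deg_exp_eq_binomial deg_log1p_nth_0 flip: fps_compose_assoc)
  then show ?thesis
    using assms by (simp add: fps_binomial_compose_fps_binomial fps_binomial_1)
qed

lemma sum_deg_Bell_deg_Stirling1:
  assumes "\<mu> \<noteq> 0"
  shows "(\<Sum>k=0..n. deg_Bell \<mu> k 1 * deg_Stirling1 \<mu> n k) = deg_falling \<mu> 1 n"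
proof -
  let ?E = "deg_exp \<mu> 1"
  have "(?E oo (?E - 1)) oo deg_log1p \<mu> = ?E oo ((?E - 1) oo deg_log1p \<mu>)"
    by (simp add: fps_compose_assoc deg_exp_nth_0 deg_log1p_nth_0)
  also have "\<dots> = ?E"
    using assms by (simp add: fps_compose_sub_distrib deg_exp_compose_deg_log1p)
  finally have "(?E oo (?E - 1)) oo deg_log1p \<mu> = ?E" .
  then show ?thesis
    unfolding deg_Bell_def deg_Stirling1_def sum_fact_nth_eq_compose
    by (simp add: deg_exp_def)
qed

lemma derangement_series_compose:
  assumes "\<mu> \<noteq> 0"
  defines "E \<equiv> deg_exp (- \<mu>) 1"
  shows "(1 / (1 - fps_X) * deg_exp \<mu> (-1)) oo (1 - E) = (E oo (E - 1)) * deg_exp (- \<mu>) (-1)"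
proof -
  have E0: "E $ 0 = 1"
    by (simp add: E_def deg_exp_nth_0)
  then have 0: "(1 - E) $ 0 = 0" "(E - 1) $ 0 = 0"
    by simp_all
  have inv: "deg_exp (- \<mu>) (-1) * E = 1"
    using assms(1) by (simp add: E_def deg_exp_0 flip: deg_exp_add)
  \<comment> \<open>Substituting 1 - E into 1 / (1 - t) gives the reciprocal of E. Both sides equal
    1 here, and cancelling E identifies this reciprocal with
    \<open>deg_exp (- \<mu>) (-1)\<close>.\<close>
  have "((1 / (1 - fps_X :: real fps)) oo (1 - E)) * E = deg_exp (- \<mu>) (-1) * E"
  proof -
    have "(1 / (1 - fps_X :: real fps)) * (1 - fps_X) = 1"
      by (simp add: fps_divide_unit inverse_mult_eq_1)
    then have "((1 / (1 - fps_X :: real fps)) * (1 - fps_X)) oo (1 - E) = 1"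
      by simp
    then show ?thesis
      by (simp only: fps_compose_mult_distrib[OF 0(1)] fps_compose_sub_distrib fps_compose_1
          fps_X_fps_compose_startby0[OF 0(1)]) (simp add: inv)
  qed
  moreover have "E \<noteq> 0"
    using E0 by auto
  ultimately have "(1 / (1 - fps_X :: real fps)) oo (1 - E) = deg_exp (- \<mu>) (-1)"
    by (metis (no_types) mult_right_cancel)
  moreover have "deg_exp \<mu> (-1) oo (1 - E) = E oo (E - 1)"
  proof -
    have "deg_exp \<mu> (-1) = E oo (- fps_X)"
      using deg_exp_minus[of "- \<mu>" 1] by (simp add: E_def)
    moreover have "(- fps_X) oo (1 - E) = E - 1"
      by (simp add: fps_compose_uminus E0)
    ultimately show ?thesis
      by (simp add: E0 flip: fps_compose_assoc)
  qed
  ultimately show ?thesis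
    by (simp only: fps_compose_mult_distrib[OF 0(1)] mult.commute)
qed

lemma sum_deg_derangement_deg_Stirling2:
  assumes "\<mu> \<noteq> 0"
  shows "(\<Sum>m=0..n. (-1) ^ m * deg_derangement \<mu> m 0 * deg_Stirling2 (- \<mu>) n m)
           = (\<Sum>m=0..n. real (n choose m) * deg_Bell (- \<mu>) m 1 * deg_falling (- \<mu>) (-1) (n - m))"
proof -
  let ?E = "deg_exp (- \<mu>) 1"
  \<comment> \<open>The sign is absorbed into the m-th power, so the series to substitute is 1 - E
    instead of E - 1.\<close>
  have sign: "(-1) ^ m * deg_Stirling2 (- \<mu>) n m
      = fact n * fps_nth (fps_const (1 / fact m) * (1 - ?E) ^ m) n" for m
  proof -
    have "(1 - ?E) ^ m = fps_const ((-1) ^ m) * (?E - 1) ^ m"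
      by (metis fps_const_1_eq_1 fps_const_neg fps_const_power minus_diff_eq power_minus)
    then show ?thesis
      by (simp add: deg_Stirling2_def)
  qed
  have "(\<Sum>m=0..n. (-1) ^ m * deg_derangement \<mu> m 0 * deg_Stirling2 (- \<mu>) n m)
      = (\<Sum>m=0..n. deg_derangement \<mu> m 0 * ((-1) ^ m * deg_Stirling2 (- \<mu>) n m))"
    by (simp only: mult_ac)
  also have "\<dots> = fact n * fps_nth ((?E oo (?E - 1)) * deg_exp (- \<mu>) (-1)) n"
    unfolding sign deg_derangement_def sum_fact_nth_eq_compose
    using derangement_series_compose[OF assms] by simp
  \<comment> \<open>In the Cauchy product, n! / (m! (n - m)!) is the binomial coefficient.\<close>
  also have "\<dots> = (\<Sum>m=0..n. real (n choose m) * deg_Bell (- \<mu>) m 1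
      * deg_falling (- \<mu>) (-1) (n - m))"
    unfolding fps_mult_nth sum_distrib_left
    by (intro sum.cong) (simp_all add: deg_Bell_def deg_exp_def binomial_fact)
  finally show ?thesis .
qed

theorem theorem8:
  fixes lam :: real and n :: nat
  assumes "lam \<noteq> 0"
  shows "(\<Sum>m=0..n. (-1) ^ m * deg_derangement lam m 0 * deg_Stirling2 (- lam) n m)
           = (\<Sum>m=0..n. real (n choose m) * deg_Bell (- lam) m 1 * deg_falling (- lam) (-1) (n - m))
       \<and> (\<Sum>k=0..n. deg_Bell lam k 1 * deg_Stirling1 lam n k)
           = (-1) ^ n * deg_falling (- lam) (-1) n"
proof -
  have "(-1) ^ n * deg_falling (- lam) (-1) n = deg_falling lam 1 n"
    using deg_falling_minus[of "- lam" "-1" n] by simp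
  then show ?thesis
    using sum_deg_derangement_deg_Stirling2[OF assms] sum_deg_Bell_deg_Stirling1[OF assms]
    by simp
qed

end
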